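(* Let $\alpha\in(0,3]$ and let $h\in\mathcal{F}(\alpha)$. Then $$\operatorname{Re}\left(\frac{zh''(z)}{h'(z)}\right)\ \geq\ -\frac{\alpha}{2}+\left(\frac{1-|z|^2}{2\alpha}\right)\left|\frac{h''(z)}{h'(z)}\right|^2\quad\text{for all } z\in\mathbb{D}.$$ Moreover, strict inequality holds for all $z\in\mathbb{D}$ unless $h'(z)=(1-z\zeta)^{-\alpha}$ (for all $z \in \mathbb{D}$) for some $\zeta\in\mathbb{T}$.
   Context: $\mathbb{D}=\{z\in\mathbb{C}:|z|<1\}$ and $\mathbb{T}=\{z\in\mathbb{C}:|z|=1\}$. $\mathcal{A}$ is the family of analytic functions $h$ in $\mathbb{D}$ with $h(0)=0$ and $h'(0)=1$. For $\alpha\in(0,3]$, $\mathcal{F}(\alpha)$ is the family of locally univalent functions $h\in\mathcal{A}$ (i.e. $h'(z)\neq0$ in $\mathbb{D}$) such that $\operatorname{Re}\left(1+\frac{zh''(z)}{h'(z)}\right)>1-\frac{\alpha}{2}$ for all $z\in\mathbb{D}$. Powers $(1-z\zeta)^{-\alpha}$ are taken with the branch equal to $1$ at $z=0$. *)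

theory Defs
  imports "HOL-Complex_Analysis.Complex_Analysis"
begin

abbreviation unit_disc :: "complex set" where
  "unit_disc \<equiv> ball 0 1"

abbreviation unit_circle :: "complex set" where
  "unit_circle \<equiv> sphere 0 1"

definition class_A :: "(complex \<Rightarrow> complex) set" where
  "class_A = {h. h analytic_on unit_disc \<and> h 0 = 0 \<and> deriv h 0 = 1}"

definition class_F :: "real \<Rightarrow> (complex \<Rightarrow> complex) set" where
  "class_F \<alpha> = {h \<in> class_A.
     (\<forall>z\<in>unit_disc. deriv h z \<noteq> 0) \<and>
     (\<forall>z\<in>unit_disc. Re (1 + z * deriv (deriv h) z / deriv h z) > 1 - \<alpha> / 2)}"

(* For |z| < 1 and |zeta| = 1 the point 1 - z * zeta lies in the right half-plane, where the
   principal branch used by powr is analytic; it takes the value 1 at z = 0. *)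
definition extremal_deriv :: "real \<Rightarrow> complex \<Rightarrow> complex \<Rightarrow> complex" where
  "extremal_deriv \<alpha> \<zeta> z = (1 - z * \<zeta>) powr (- complex_of_real \<alpha>)"

end

theory Submission imports Defs begin

text \<open>
  Write \<open>P = h'' / h'\<close> for the pre-Schwarzian derivative. The hypothesis \<open>Re (z P) > - \<alpha> / 2\<close> says
  exactly that \<open>|z P| < |\<alpha> + z P|\<close>, so \<open>\<phi> = P / (\<alpha> + z P)\<close> is holomorphic in the disc and
  \<open>z \<phi>(z)\<close> is a self-map of the disc fixing the origin. The Schwarz lemma improves
  \<open>|z \<phi>(z)| < 1\<close> to \<open>|\<phi>| \<le> 1\<close>, that is \<open>|P| \<le> |\<alpha> + z P|\<close>; squaring this and expanding the
  right-hand side gives the asserted lower bound for \<open>Re (z P)\<close>.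

  Equality at a single point means \<open>|\<phi>| = 1\<close> there. The equality case of the Schwarz lemma then
  makes \<open>\<phi>\<close> a unimodular constant \<open>\<zeta>\<close>, so \<open>P = \<alpha> \<zeta> / (1 - z \<zeta>)\<close>, and integrating this
  logarithmic derivative with \<open>h'(0) = 1\<close> yields \<open>h'(z) = (1 - z \<zeta>)\<close> to the power \<open>- \<alpha>\<close>.
\<close>

text \<open>
  This identity turns both the half-plane condition and the asserted inequality into comparisons
  of moduli: of \<open>|z P|\<close> with \<open>|a + z P|\<close> in the first case, of \<open>|P|\<close> with \<open>|a + z P|\<close> in the second.
\<close>
lemma cmod_add_of_real_power2:
  "(cmod (complex_of_real a + w))\<^sup>2 = a\<^sup>2 + 2 * a * Re w + (cmod w)\<^sup>2"
  unfolding cmod_power2 by (simp add: power2_eq_square algebra_simps)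

lemma less_Re_iff_cmod_add_of_real:
  assumes "0 < a"
  shows "- a / 2 + (1 - (cmod z)\<^sup>2) / (2 * a) * (cmod p)\<^sup>2 < Re (z * p)
           \<longleftrightarrow> cmod p < cmod (complex_of_real a + z * p)"
    and "- a / 2 + (1 - (cmod z)\<^sup>2) / (2 * a) * (cmod p)\<^sup>2 \<le> Re (z * p)
           \<longleftrightarrow> cmod p \<le> cmod (complex_of_real a + z * p)"
proof -
  let ?d = "Re (z * p) - (- a / 2 + (1 - (cmod z)\<^sup>2) / (2 * a) * (cmod p)\<^sup>2)"
  have d: "(cmod (complex_of_real a + z * p))\<^sup>2 - (cmod p)\<^sup>2 = 2 * a * ?d"
    unfolding cmod_add_of_real_power2 norm_mult power_mult_distrib
    using assms by (simp add: field_simps power2_eq_square)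
  have "0 < ?d \<longleftrightarrow> 0 < 2 * a * ?d" and "0 \<le> ?d \<longleftrightarrow> 0 \<le> 2 * a * ?d"
    using assms by (simp_all add: zero_less_mult_iff zero_le_mult_iff)
  then have "0 < ?d \<longleftrightarrow> (cmod p)\<^sup>2 < (cmod (complex_of_real a + z * p))\<^sup>2"
    and "0 \<le> ?d \<longleftrightarrow> (cmod p)\<^sup>2 \<le> (cmod (complex_of_real a + z * p))\<^sup>2"
    unfolding d[symmetric] by simp_all
  then show "- a / 2 + (1 - (cmod z)\<^sup>2) / (2 * a) * (cmod p)\<^sup>2 < Re (z * p)
           \<longleftrightarrow> cmod p < cmod (complex_of_real a + z * p)"
    and "- a / 2 + (1 - (cmod z)\<^sup>2) / (2 * a) * (cmod p)\<^sup>2 \<le> Re (z * p)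
           \<longleftrightarrow> cmod p \<le> cmod (complex_of_real a + z * p)"
    by (simp_all flip: not_le)
qed

text \<open>
  This is the Schwarz lemma for \<open>z * \<phi> z\<close>, with the factor \<open>z\<close> cancelled. The derivative of that
  function at the origin is \<open>\<phi> 0\<close>, so the two alternatives in the equality case of the Schwarz
  lemma, a point \<open>z \<noteq> 0\<close> or the derivative at the origin, merge into the single condition that
  \<open>\<phi>\<close> has modulus one at some point of the disc.
\<close>
lemma Schwarz_quotient:
  assumes hol: "\<phi> holomorphic_on ball 0 1"
    and less: "\<And>z. cmod z < 1 \<Longrightarrow> cmod (z * \<phi> z) < 1"
    and w: "cmod w < 1"
  shows "cmod (\<phi> w) \<le> 1"
    and "cmod (\<phi> w) = 1 \<Longrightarrow> \<exists>\<zeta>. cmod \<zeta> = 1 \<and> (\<forall>z. cmod z < 1 \<longrightarrow> \<phi> z = \<zeta>)"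
proof -
  let ?f = "\<lambda>z. z * \<phi> z"
  have holf: "?f holomorphic_on ball 0 1"
    using hol by (intro holomorphic_intros)
  have "(\<phi> has_field_derivative deriv \<phi> 0) (at 0)"
    using holomorphic_derivI[OF hol, of 0] by simp
  then have "(?f has_field_derivative \<phi> 0) (at 0)"
    by (auto intro!: derivative_eq_intros)
  then have deriv0: "deriv ?f 0 = \<phi> 0"
    by (rule DERIV_imp_deriv)
  note schwarz = Schwarz_Lemma[OF holf _ less]
  show "cmod (\<phi> w) \<le> 1"
  proof (cases "w = 0")
    case True
    then show ?thesis using schwarz(2)[of 0] deriv0 by simp
  next
    case False
    then show ?thesis using schwarz(1)[of w] w by (simp add: norm_mult)
  qed
  show "\<exists>\<zeta>. cmod \<zeta> = 1 \<and> (\<forall>z. cmod z < 1 \<longrightarrow> \<phi> z = \<zeta>)" if "cmod (\<phi> w) = 1"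
  proof -
    have "(\<exists>z. cmod z < 1 \<and> z \<noteq> 0 \<and> cmod (?f z) = cmod z) \<or> cmod (deriv ?f 0) = 1"
      using that w deriv0 by (cases "w = 0") (auto simp: norm_mult)
    then obtain \<zeta> where \<zeta>: "cmod \<zeta> = 1" and eq: "\<And>z. cmod z < 1 \<Longrightarrow> ?f z = \<zeta> * z"
      using schwarz(3)[of 0] by fastforce
    \<comment> \<open>Cancelling \<open>z\<close> says nothing about \<open>\<phi> 0\<close>; comparing derivatives at the origin does.\<close>
    have "deriv ?f 0 = deriv (\<lambda>z. \<zeta> * z) 0"
      using holf by (rule complex_derivative_transform_within_open[of _ "ball 0 1"])
        (auto intro!: holomorphic_intros simp: eq)
    then have "\<phi> 0 = \<zeta>" using deriv0 by simp
    moreover have "\<phi> z = \<zeta>" if "cmod z < 1" "z \<noteq> 0" for z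
      using eq[OF that(1)] that(2) by simp
    ultimately show ?thesis using \<zeta> by metis
  qed
qed

text \<open>
  The half-plane condition makes \<open>1 + 2 z P / a\<close> a function of positive real part with value \<open>1\<close>
  at the origin. Its Cayley transform is \<open>z P / (a + z P)\<close>, a self-map of the disc that vanishes at
  the origin, and the Schwarz lemma applies to it.
\<close>
lemma half_plane_bound:
  assumes a: "0 < a"
    and hol: "P holomorphic_on ball 0 1"
    and Re: "\<And>z. cmod z < 1 \<Longrightarrow> Re (z * P z) > - a / 2"
    and w: "cmod w < 1"
  shows "cmod (P w) \<le> cmod (complex_of_real a + w * P w)"
    and "cmod (P w) = cmod (complex_of_real a + w * P w) \<Longrightarrow>
           \<exists>\<zeta>. cmod \<zeta> = 1 \<and> (\<forall>z. cmod z < 1 \<longrightarrow> P z * (1 - z * \<zeta>) = of_real a * \<zeta>)"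
proof -
  define \<phi> where "\<phi> z = P z / (complex_of_real a + z * P z)" for z
  have nz: "complex_of_real a + z * P z \<noteq> 0" if "cmod z < 1" for z
  proof
    assume "complex_of_real a + z * P z = 0"
    then have "Re (complex_of_real a + z * P z) = 0" by simp
    with Re[OF that] a show False by simp
  qed
  have hol\<phi>: "\<phi> holomorphic_on ball 0 1"
    unfolding \<phi>_def using hol nz by (intro holomorphic_intros) auto
  have less: "cmod (z * \<phi> z) < 1" if "cmod z < 1" for z
  proof -
    have "0 < a * (a + 2 * Re (z * P z))"
      using a Re[OF that] by (intro mult_pos_pos) auto
    then have "(cmod (z * P z))\<^sup>2 < (cmod (complex_of_real a + z * P z))\<^sup>2"
      unfolding cmod_add_of_real_power2 by (simp add: power2_eq_square algebra_simps)
    then have "cmod (z * P z) < cmod (complex_of_real a + z * P z)"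
      by (rule power_less_imp_less_base) simp
    then show ?thesis
      using nz[OF that] by (simp add: \<phi>_def norm_divide norm_mult divide_simps)
  qed
  note sch = Schwarz_quotient[OF hol\<phi> less w]
  show "cmod (P w) \<le> cmod (complex_of_real a + w * P w)"
    using sch(1) nz[OF w] by (simp add: \<phi>_def norm_divide divide_simps)
  assume "cmod (P w) = cmod (complex_of_real a + w * P w)"
  then have "cmod (\<phi> w) = 1"
    using nz[OF w] by (simp add: \<phi>_def norm_divide)
  with sch(2) obtain \<zeta> where \<zeta>: "cmod \<zeta> = 1"
    and eq: "\<And>z. cmod z < 1 \<Longrightarrow> \<phi> z = \<zeta>" by blast
  have "P z * (1 - z * \<zeta>) = of_real a * \<zeta>" if z: "cmod z < 1" for z
  proof -
    have "P z = \<zeta> * (of_real a + z * P z)"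
      using eq[OF z] nz[OF z] by (simp add: \<phi>_def field_simps)
    then show ?thesis by (simp add: algebra_simps)
  qed
  with \<zeta> show "\<exists>\<zeta>. cmod \<zeta> = 1 \<and>
      (\<forall>z. cmod z < 1 \<longrightarrow> P z * (1 - z * \<zeta>) = of_real a * \<zeta>)"
    by blast
qed

text \<open>
  The differential equation says that \<open>g z * (1 - z * \<zeta>) powr c\<close> has derivative zero, so this
  product keeps its value \<open>1\<close> at the origin. The principal branch of the power is differentiable
  because \<open>1 - z * \<zeta>\<close> stays in the right half-plane.
\<close>
lemma log_deriv_imp_powr:
  assumes hol: "g holomorphic_on ball 0 1" and g0: "g 0 = 1"
    and \<zeta>: "cmod \<zeta> = 1"
    and ode: "\<And>z. cmod z < 1 \<Longrightarrow> deriv g z * (1 - z * \<zeta>) = c * \<zeta> * g z"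
    and w: "cmod w < 1"
  shows "g w = (1 - w * \<zeta>) powr (- c)"
proof -
  have Re_pos: "0 < Re (1 - z * \<zeta>)" if "cmod z < 1" for z
    using complex_Re_le_cmod[of "z * \<zeta>"] that \<zeta> by (simp add: norm_mult)
  define F where "F z = g z * (1 - z * \<zeta>) powr c" for z
  have F': "(F has_field_derivative 0) (at z within ball 0 1)" if "z \<in> ball 0 1" for z
  proof -
    from that have z: "cmod z < 1" by simp
    have nonpos: "1 - z * \<zeta> \<notin> \<real>\<^sub>\<le>\<^sub>0"
      using Re_pos[OF z] unfolding complex_nonpos_Reals_iff by linarith
    then have nz: "1 - z * \<zeta> \<noteq> 0"
      by force
    have g': "(g has_field_derivative deriv g z) (at z)"
      using holomorphic_derivI[OF hol] that by simp
    have "(F has_field_derivative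
             deriv g z * (1 - z * \<zeta>) powr c + g z * (c * (1 - z * \<zeta>) powr (c - 1) * (- \<zeta>))) (at z)"
      unfolding F_def
      by (rule derivative_eq_intros g' has_field_derivative_powr[THEN DERIV_chain2] nonpos refl
          | simp)+
    moreover have split: "(1 - z * \<zeta>) powr c = (1 - z * \<zeta>) powr (c - 1) * (1 - z * \<zeta>)"
      using nz by (simp add: powr_diff)
    have "deriv g z * (1 - z * \<zeta>) powr c + g z * (c * (1 - z * \<zeta>) powr (c - 1) * (- \<zeta>))
        = (1 - z * \<zeta>) powr (c - 1) * (deriv g z * (1 - z * \<zeta>) - c * \<zeta> * g z)"
      by (simp only: split) (simp add: algebra_simps)
    ultimately have "(F has_field_derivative 0) (at z)"
      using ode[OF z] by simp
    then show ?thesis by (rule has_field_derivative_at_within)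
  qed
  obtain k where k: "\<And>z. z \<in> ball 0 1 \<Longrightarrow> F z = k"
    using has_field_derivative_zero_constant[OF convex_ball F'] by blast
  have "F w = F 0" using k w by simp
  then have "g w * (1 - w * \<zeta>) powr c = 1" by (simp add: F_def g0)
  then show ?thesis
    by (metis inverse_unique mult.commute powr_minus)
qed

theorem theorem2p1:
  fixes \<alpha> :: real and h :: "complex \<Rightarrow> complex"
  assumes "0 < \<alpha>" and "\<alpha> \<le> 3" and "h \<in> class_F \<alpha>"
  shows "(\<forall>z\<in>unit_disc.
            Re (z * deriv (deriv h) z / deriv h z)
              \<ge> - \<alpha> / 2 + (1 - (cmod z)\<^sup>2) / (2 * \<alpha>) * (cmod (deriv (deriv h) z / deriv h z))\<^sup>2)
       \<and> (\<not> (\<exists>\<zeta>\<in>unit_circle. \<forall>z\<in>unit_disc. deriv h z = extremal_deriv \<alpha> \<zeta> z)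
          \<longrightarrow> (\<forall>z\<in>unit_disc.
                Re (z * deriv (deriv h) z / deriv h z)
                  > - \<alpha> / 2 + (1 - (cmod z)\<^sup>2) / (2 * \<alpha>) * (cmod (deriv (deriv h) z / deriv h z))\<^sup>2))"
proof -
  define P where "P z = deriv (deriv h) z / deriv h z" for z
  have h: "h analytic_on unit_disc" "deriv h 0 = 1"
    and nz: "\<And>z. cmod z < 1 \<Longrightarrow> deriv h z \<noteq> 0"
    and Re: "\<And>z. cmod z < 1 \<Longrightarrow> Re (z * P z) > - \<alpha> / 2"
    using assms(3) by (auto simp: class_F_def class_A_def P_def)
  have hol1: "deriv h holomorphic_on ball 0 1"
    using analytic_imp_holomorphic[OF h(1)] by (rule holomorphic_deriv) simp
  have hol2: "deriv (deriv h) holomorphic_on ball 0 1"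
    using hol1 by (rule holomorphic_deriv) simp
  have holP: "P holomorphic_on ball 0 1"
    unfolding P_def using hol2 hol1 by (rule holomorphic_on_divide) (simp add: nz)
  note bound = half_plane_bound[OF assms(1) holP Re]
  have P: "Re (z * deriv (deriv h) z / deriv h z) = Re (z * P z)" for z
    by (simp add: P_def)
  have extremal: "\<exists>\<zeta>\<in>unit_circle. \<forall>z\<in>unit_disc. deriv h z = extremal_deriv \<alpha> \<zeta> z"
    if w: "cmod w < 1" and eq: "cmod (P w) = cmod (complex_of_real \<alpha> + w * P w)" for w
  proof -
    obtain \<zeta> where \<zeta>: "cmod \<zeta> = 1"
      and P\<zeta>: "\<And>z. cmod z < 1 \<Longrightarrow> P z * (1 - z * \<zeta>) = of_real \<alpha> * \<zeta>"
      using bound(2)[OF _ w eq] by blast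
    have "deriv (deriv h) z * (1 - z * \<zeta>) = of_real \<alpha> * \<zeta> * deriv h z" if "cmod z < 1" for z
      using P\<zeta>[OF that] nz[OF that] by (simp add: P_def field_simps)
    from log_deriv_imp_powr[OF hol1 h(2) \<zeta> this]
    have "\<forall>z\<in>unit_disc. deriv h z = extremal_deriv \<alpha> \<zeta> z"
      by (simp add: extremal_deriv_def)
    with \<zeta> show ?thesis by auto
  qed
  show ?thesis
    unfolding P P_def[symmetric] less_Re_iff_cmod_add_of_real[OF assms(1)]
    using bound(1) extremal by (metis mem_ball_0 order_le_imp_less_or_eq)
qed

end
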